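(* Let $\mathbf{b}=(b^x,b^y,b^z)$ be a divergence-free vector field on the box $\Omega$, let $\alpha,\beta\in[0,1]$, and let $\mathbf{C}_{pq}$ and $\mathbf{C}_{qp}$ be the matrices of the discrete parallel gradients $\nabla_\parallel|_{pq}$ (from $q$-grid to $p$-grid, with parameter $\alpha$) and $\nabla_\parallel|_{qp}$ (from $p$-grid to $q$-grid, with parameter $\beta$) under homogeneous Dirichlet boundary conditions, as defined in the context. If $\alpha+\beta=1$, then the divergence theorem with homogeneous Dirichlet boundary conditions holds at the discrete level, that is, $$\vec p^{\,T}\mathbf{X}_p\mathbf{C}_{pq}\vec q+\vec q^{\,T}\mathbf{X}_q\mathbf{C}_{qp}\vec p=0$$ for all vectors $\vec p$ of $p$-grid values (vanishing at the boundary nodes) and all vectors $\vec q$ of $q$-grid values. Moreover, $\mathbf{C}_{pq}=-\mathbf{C}_{qp}^T$.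
   Context: **Continuous identity.** For $\nabla\cdot\mathbf{b}=0$, put $\nabla_\parallel f=\mathbf{b}\cdot\nabla f=\nabla\cdot(\mathbf{b}f)$. The divergence theorem states $\int_\Omega p\nabla_\parallel q\,d\Omega+\int_\Omega q\nabla_\parallel p\,d\Omega=\int_{\partial\Omega}pq\,\mathbf{b}\cdot\mathbf{n}\,ds$. With homogeneous Dirichlet conditions the right-hand side is $0$. The claim is the discrete analogue. **Grids.** $\Omega\subset\mathbb{R}^3$ is a closed rectangular box. The $p$-grid is the uniform Cartesian grid of nodes $(x_i,y_j,z_k)$, $1\le i\le N_x^p$, $1\le j\le N_y^p$, $1\le k\le N_z^p$, with spacings $\Delta x,\Delta y,\Delta z$, whose first and last nodes in each direction lie on $\partial\Omega$. Write $i^\pm=i\pm\frac12$, $j^\pm=j\pm\frac12$, $k^\pm=k\pm\frac12$. The $q$-grid consists of the cell centres $(x_{i^+},y_{j^+},z_{k^+})$, with $1\le i\le N_x^q=N_x^p-1$, $1\le j\le N_y^q=N_y^p-1$, $1\le k\le N_z^q=N_z^p-1$; it has no nodes on $\partial\Omega$. The field $\mathbf{b}$ is given and can be evaluated on both grids. A grid function is identified with a vector by a fixed enumeration of the nodes. **Boundary conditions.** Homogeneous Dirichlet conditions mean that the $p$-grid values at nodes on $\partial\Omega$ are set to $0$, so the degrees of freedom of $\vec p$ are the values at the interior $p$-nodes ($2\le i\le N_x^p-1$, etc.). Correspondingly, $\mathbf{C}_{pq}$ has rows indexed by interior $p$-nodes and columns indexed by all $q$-nodes, and $\mathbf{C}_{qp}$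 has rows indexed by all $q$-nodes and columns indexed by interior $p$-nodes (it acts on $p$-grid functions extended by $0$ to the boundary nodes). **Discrete derivatives.** For $f$ on the $q$-grid and $(x_i,y_j,z_k)$ an interior $p$-node, $$[D_x|_{pq}f](x_i,y_j,z_k)=\frac{1}{4\Delta x}\sum_{s\in\{j^-,j^+\}}\ \sum_{t\in\{k^-,k^+\}}\big(f(x_{i^+},y_s,z_t)-f(x_{i^-},y_s,z_t)\big).$$ For $f$ on the $p$-grid, $$[D_x|_{qp}f](x_{i^+},y_{j^+},z_{k^+})=\frac{1}{4\Delta x}\sum_{s\in\{j,j+1\}}\ \sum_{t\in\{k,k+1\}}\big(f(x_{i+1},y_s,z_t)-f(x_i,y_s,z_t)\big).$$ $D_y|_{pq},D_z|_{pq},D_y|_{qp},D_z|_{qp}$ are defined analogously (difference in the named direction, average over the four pairs in the other two directions). **Discrete parallel gradients.** For $f$ on the $q$-grid, at a $p$-node, $$\nabla_\parallel|_{pq}f=\alpha\sum_{\delta\in\{x,y,z\}}b^\delta\,D_\delta|_{pq}f+(1-\alpha)\sum_{\delta\in\{x,y,z\}}D_\delta|_{pq}(b^\delta f),$$ where in the first sum $b^\delta$ is evaluated at the $p$-node and in the second the product $b^\delta f$ is formed on the $q$-grid. For $f$ on the $p$-grid, at a $q$-node, $$\nabla_\parallel|_{qp}f=\beta\sum_{\delta\in\{x,y,z\}}b^\delta\,D_\delta|_{qp}f+(1-\beta)\sum_{\delta\in\{x,y,z\}}D_\delta|_{qp}(b^\delta f),$$ where in the first sum $b^\delta$ is evaluated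 at the $q$-node and in the second $b^\delta f$ is formed on the $p$-grid. $\mathbf{C}_{pq}$ and $\mathbf{C}_{qp}$ are the matrices of these linear maps. **Quadrature matrices.** $\mathbf{X}_p$ and $\mathbf{X}_q$ are the diagonal positive definite matrices of quadrature weights defining the discrete $L^2$ norms $\|\vec p\|^2=\vec p^{\,T}\mathbf{X}_p\vec p$ and $\|\vec q\|^2=\vec q^{\,T}\mathbf{X}_q\vec q$. $\mathbf{X}_q$ is $\Delta x\Delta y\Delta z$ times the identity. $\mathbf{X}_p$ is given by the trapezoidal rule; on the interior $p$-nodes (the only degrees of freedom here) all its diagonal entries equal $\Delta x\Delta y\Delta z$. *)

theory Defs
  imports "HOL-Analysis.Analysis" "Jordan_Normal_Form.Matrix"
begin

text \<open>Both libraries claim the infix \<open>$\<close>; here it always denotes a component of a vector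
  in \<open>real^3\<close>.\<close>
no_notation Matrix.vec_index (infixl "$" 100)

type_synonym node = "nat \<times> nat \<times> nat"

record staggered_grid =
  lo :: "real^3"
  hi :: "real^3"
  Nx :: nat
  Ny :: nat
  Nz :: nat

text \<open>\<open>Nx\<close>, \<open>Ny\<close>, \<open>Nz\<close> count the \<open>p\<close>-nodes per direction. The box is nondegenerate and its two
  opposite faces carry different nodes, so each count is at least 2.\<close>
definition valid_grid :: "staggered_grid \<Rightarrow> bool" where
  "valid_grid G \<longleftrightarrow> (\<forall>d. lo G $ d < hi G $ d) \<and> Nx G \<ge> 2 \<and> Ny G \<ge> 2 \<and> Nz G \<ge> 2"

definition Omega :: "staggered_grid \<Rightarrow> (real^3) set" where
  "Omega G = cbox (lo G) (hi G)"

definition dx :: "staggered_grid \<Rightarrow> real" where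
  "dx G = (hi G $ 1 - lo G $ 1) / (real (Nx G) - 1)"

definition dy :: "staggered_grid \<Rightarrow> real" where
  "dy G = (hi G $ 2 - lo G $ 2) / (real (Ny G) - 1)"

definition dz :: "staggered_grid \<Rightarrow> real" where
  "dz G = (hi G $ 3 - lo G $ 3) / (real (Nz G) - 1)"

text \<open>The index \<open>(i, j, k)\<close> stands for the \<open>p\<close>-node $(x_i, y_j, z_k)$ on the \<open>p\<close>-grid and for the
  cell centre $(x_{i+1/2}, y_{j+1/2}, z_{k+1/2})$ on the \<open>q\<close>-grid. All indices start at 1.\<close>

fun p_point :: "staggered_grid \<Rightarrow> node \<Rightarrow> real^3" where
  "p_point G (i, j, k) =
     vector [lo G $ 1 + (real i - 1) * dx G,
             lo G $ 2 + (real j - 1) * dy G,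
             lo G $ 3 + (real k - 1) * dz G]"

fun q_point :: "staggered_grid \<Rightarrow> node \<Rightarrow> real^3" where
  "q_point G (i, j, k) =
     vector [lo G $ 1 + (real i - 1/2) * dx G,
             lo G $ 2 + (real j - 1/2) * dy G,
             lo G $ 3 + (real k - 1/2) * dz G]"

definition interior_p_nodes :: "staggered_grid \<Rightarrow> node set" where
  "interior_p_nodes G = {2..Nx G - 1} \<times> {2..Ny G - 1} \<times> {2..Nz G - 1}"

definition q_nodes :: "staggered_grid \<Rightarrow> node set" where
  "q_nodes G = {1..Nx G - 1} \<times> {1..Ny G - 1} \<times> {1..Nz G - 1}"

definition divergence_free_on :: "(real^3) set \<Rightarrow> (real^3 \<Rightarrow> real^3) \<Rightarrow> bool" where
  "divergence_free_on S b \<longleftrightarrow>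
     continuous_on S b \<and>
     (\<forall>x\<in>interior S. \<exists>D. (b has_derivative D) (at x) \<and> (\<Sum>d\<in>UNIV. D (axis d 1) $ d) = 0)"

text \<open>In the operators from the \<open>q\<close>-grid to the \<open>p\<close>-grid, the half-integer positions
  $i^+$ and $i^-$ are the \<open>q\<close>-indices \<open>i\<close> and \<open>i - 1\<close>. They are used at interior \<open>p\<close>-nodes only,
  where the indices are at least 2.\<close>

fun Dx_pq :: "staggered_grid \<Rightarrow> (node \<Rightarrow> real) \<Rightarrow> node \<Rightarrow> real" where
  "Dx_pq G f (i, j, k) =
     1 / (4 * dx G) * (\<Sum>s\<in>{j - 1, j}. \<Sum>t\<in>{k - 1, k}. f (i, s, t) - f (i - 1, s, t))"

fun Dy_pq :: "staggered_grid \<Rightarrow> (node \<Rightarrow> real) \<Rightarrow> node \<Rightarrow> real" where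
  "Dy_pq G f (i, j, k) =
     1 / (4 * dy G) * (\<Sum>r\<in>{i - 1, i}. \<Sum>t\<in>{k - 1, k}. f (r, j, t) - f (r, j - 1, t))"

fun Dz_pq :: "staggered_grid \<Rightarrow> (node \<Rightarrow> real) \<Rightarrow> node \<Rightarrow> real" where
  "Dz_pq G f (i, j, k) =
     1 / (4 * dz G) * (\<Sum>r\<in>{i - 1, i}. \<Sum>s\<in>{j - 1, j}. f (r, s, k) - f (r, s, k - 1))"

fun Dx_qp :: "staggered_grid \<Rightarrow> (node \<Rightarrow> real) \<Rightarrow> node \<Rightarrow> real" where
  "Dx_qp G f (i, j, k) =
     1 / (4 * dx G) * (\<Sum>s\<in>{j, j + 1}. \<Sum>t\<in>{k, k + 1}. f (i + 1, s, t) - f (i, s, t))"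

fun Dy_qp :: "staggered_grid \<Rightarrow> (node \<Rightarrow> real) \<Rightarrow> node \<Rightarrow> real" where
  "Dy_qp G f (i, j, k) =
     1 / (4 * dy G) * (\<Sum>r\<in>{i, i + 1}. \<Sum>t\<in>{k, k + 1}. f (r, j + 1, t) - f (r, j, t))"

fun Dz_qp :: "staggered_grid \<Rightarrow> (node \<Rightarrow> real) \<Rightarrow> node \<Rightarrow> real" where
  "Dz_qp G f (i, j, k) =
     1 / (4 * dz G) * (\<Sum>r\<in>{i, i + 1}. \<Sum>s\<in>{j, j + 1}. f (r, s, k + 1) - f (r, s, k))"

definition grad_pq ::
  "staggered_grid \<Rightarrow> (real^3 \<Rightarrow> real^3) \<Rightarrow> real \<Rightarrow> (node \<Rightarrow> real) \<Rightarrow> node \<Rightarrow> real" where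
  "grad_pq G b \<alpha> f n =
     \<alpha> * (b (p_point G n) $ 1 * Dx_pq G f n
        + b (p_point G n) $ 2 * Dy_pq G f n
        + b (p_point G n) $ 3 * Dz_pq G f n)
     + (1 - \<alpha>) * (Dx_pq G (\<lambda>m. b (q_point G m) $ 1 * f m) n
                + Dy_pq G (\<lambda>m. b (q_point G m) $ 2 * f m) n
                + Dz_pq G (\<lambda>m. b (q_point G m) $ 3 * f m) n)"

definition grad_qp ::
  "staggered_grid \<Rightarrow> (real^3 \<Rightarrow> real^3) \<Rightarrow> real \<Rightarrow> (node \<Rightarrow> real) \<Rightarrow> node \<Rightarrow> real" where
  "grad_qp G b \<beta> f n =
     \<beta> * (b (q_point G n) $ 1 * Dx_qp G f n
        + b (q_point G n) $ 2 * Dy_qp G f n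
        + b (q_point G n) $ 3 * Dz_qp G f n)
     + (1 - \<beta>) * (Dx_qp G (\<lambda>m. b (p_point G m) $ 1 * f m) n
                + Dy_qp G (\<lambda>m. b (p_point G m) $ 2 * f m) n
                + Dz_qp G (\<lambda>m. b (p_point G m) $ 3 * f m) n)"

definition enumerates :: "(nat \<Rightarrow> node) \<Rightarrow> node set \<Rightarrow> bool" where
  "enumerates e S \<longleftrightarrow> bij_betw e {..<card S} S"

definition dim_p :: "staggered_grid \<Rightarrow> nat" where
  "dim_p G = card (interior_p_nodes G)"

definition dim_q :: "staggered_grid \<Rightarrow> nat" where
  "dim_q G = card (q_nodes G)"

text \<open>The grid function with nodal values \<open>v\<close> on the \<open>n\<close> enumerated nodes, extended by 0 to all
  other nodes; for the interior \<open>p\<close>-nodes this is the homogeneous Dirichlet condition.\<close>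
definition grid_fun :: "nat \<Rightarrow> (nat \<Rightarrow> node) \<Rightarrow> real Matrix.vec \<Rightarrow> node \<Rightarrow> real" where
  "grid_fun n e v m = (\<Sum>c<n. if e c = m then vec_index v c else 0)"

definition matrix_of ::
  "nat \<Rightarrow> (nat \<Rightarrow> node) \<Rightarrow> nat \<Rightarrow> (nat \<Rightarrow> node) \<Rightarrow> ((node \<Rightarrow> real) \<Rightarrow> node \<Rightarrow> real) \<Rightarrow> real Matrix.mat"
where
  "matrix_of nr er nc ec L =
     Matrix.mat nr nc (\<lambda>(r, c). L (grid_fun nc ec (unit_vec nc c)) (er r))"

definition C_pq ::
  "staggered_grid \<Rightarrow> (nat \<Rightarrow> node) \<Rightarrow> (nat \<Rightarrow> node) \<Rightarrow> (real^3 \<Rightarrow> real^3) \<Rightarrow> real \<Rightarrow> real Matrix.mat"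
where
  "C_pq G e_p e_q b \<alpha> = matrix_of (dim_p G) e_p (dim_q G) e_q (grad_pq G b \<alpha>)"

definition C_qp ::
  "staggered_grid \<Rightarrow> (nat \<Rightarrow> node) \<Rightarrow> (nat \<Rightarrow> node) \<Rightarrow> (real^3 \<Rightarrow> real^3) \<Rightarrow> real \<Rightarrow> real Matrix.mat"
where
  "C_qp G e_p e_q b \<beta> = matrix_of (dim_q G) e_q (dim_p G) e_p (grad_qp G b \<beta>)"

definition trapezoid :: "nat \<Rightarrow> nat \<Rightarrow> real" where
  "trapezoid N i = (if i = 1 \<or> i = N then 1/2 else 1)"

fun p_weight :: "staggered_grid \<Rightarrow> node \<Rightarrow> real" where
  "p_weight G (i, j, k) =
     (trapezoid (Nx G) i * dx G) * (trapezoid (Ny G) j * dy G) * (trapezoid (Nz G) k * dz G)"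

definition X_p :: "staggered_grid \<Rightarrow> (nat \<Rightarrow> node) \<Rightarrow> real Matrix.mat" where
  "X_p G e_p = mat_diag (dim_p G) (\<lambda>r. p_weight G (e_p r))"

definition X_q :: "staggered_grid \<Rightarrow> real Matrix.mat" where
  "X_q G = smult_mat (dx G * dy G * dz G) (1\<^sub>m (dim_q G))"

end

theory Submission
  imports Defs
begin

text \<open>The stencils \<open>D|\<^sub>p\<^sub>q\<close> and \<open>D|\<^sub>q\<^sub>p\<close> are negative transposes of each other: the weight with which
  the \<open>q\<close>-node \<open>m\<close> enters the derivative at the \<open>p\<close>-node \<open>n\<close> is minus the weight with which
  \<open>n\<close> enters the derivative at \<open>m\<close>. Transposition also exchanges the advective form
  (\<open>b\<close> multiplied after differencing) with the conservative form (\<open>b\<close> multiplied before it), so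
  \<open>\<alpha>\<close> of one operator must match \<open>1 - \<beta>\<close> of the other. As both quadrature matrices
  are the same multiple of the identity on the degrees of freedom, the discrete divergence
  theorem is this antisymmetry read as a bilinear form.\<close>

text \<open>The weight \<open>w\<close> keeps these functions closed under multiplication by a
  component of \<open>b\<close>, as the conservative forms require.\<close>

definition point_mass :: "'a \<Rightarrow> real \<Rightarrow> 'a \<Rightarrow> real" where
  "point_mass m w n = (if n = m then w else 0)"

lemma mult_point_mass: "(\<lambda>n. f n * point_mass m w n) = point_mass m (f m * w)"
  by (auto simp: point_mass_def)

text \<open>Both sides are nonzero only if \<open>m\<close> is one of the eight cell centres around
  the node. The sign flips because a centre to the right of the node sees the node on its
  left.\<close>

lemma Dx_pq_point_mass:
  assumes "i \<ge> 1" "j \<ge> 1" "k \<ge> 1"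
  shows "Dx_pq G (point_mass m w) (i, j, k) = - w * Dx_qp G (point_mass (i, j, k) 1) m"
proof -
  \<comment> \<open>Successor form makes the truncated \<open>i - 1\<close> a true predecessor; at 0
    the two layers of the stencil would coincide.\<close>
  obtain i' j' k' where "i = Suc i'" "j = Suc j'" "k = Suc k'"
    using assms by (metis Suc_le_D One_nat_def)
  then show ?thesis
    by (cases m) (auto simp: point_mass_def)
qed

lemma Dy_pq_point_mass:
  assumes "i \<ge> 1" "j \<ge> 1" "k \<ge> 1"
  shows "Dy_pq G (point_mass m w) (i, j, k) = - w * Dy_qp G (point_mass (i, j, k) 1) m"
proof -
  obtain i' j' k' where "i = Suc i'" "j = Suc j'" "k = Suc k'"
    using assms by (metis Suc_le_D One_nat_def)
  then show ?thesis
    by (cases m) (auto simp: point_mass_def)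
qed

lemma Dz_pq_point_mass:
  assumes "i \<ge> 1" "j \<ge> 1" "k \<ge> 1"
  shows "Dz_pq G (point_mass m w) (i, j, k) = - w * Dz_qp G (point_mass (i, j, k) 1) m"
proof -
  obtain i' j' k' where "i = Suc i'" "j = Suc j'" "k = Suc k'"
    using assms by (metis Suc_le_D One_nat_def)
  then show ?thesis
    by (cases m) (auto simp: point_mass_def)
qed

lemma point_mass_scale: "point_mass m w = (\<lambda>n. w * point_mass m 1 n)"
  by (auto simp: point_mass_def)

lemma D_qp_scale:
  "Dx_qp G (\<lambda>n. w * f n) m = w * Dx_qp G f m"
  "Dy_qp G (\<lambda>n. w * f n) m = w * Dy_qp G f m"
  "Dz_qp G (\<lambda>n. w * f n) m = w * Dz_qp G f m"
  by (cases m; simp add: algebra_simps)+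

text \<open>Factors of \<open>b\<close> at \<open>n\<close> sit in the advective part on the left
  and the conservative part on the right, both weighted by \<alpha>. Those at \<open>m\<close> sit
  the other way round, weighted by 1 - \<alpha>.\<close>

lemma grad_pq_point_mass:
  assumes "n \<in> interior_p_nodes G"
  shows "grad_pq G b \<alpha> (point_mass m 1) n = - grad_qp G b (1 - \<alpha>) (point_mass n 1) m"
proof -
  obtain i j k where n: "n = (i, j, k)" by (cases n)
  then have pos: "i \<ge> 1" "j \<ge> 1" "k \<ge> 1"
    using assms by (auto simp: interior_p_nodes_def)
  have D_qp: "Dx_qp G (point_mass n w) m = w * Dx_qp G (point_mass n 1) m"
    "Dy_qp G (point_mass n w) m = w * Dy_qp G (point_mass n 1) m"
    "Dz_qp G (point_mass n w) m = w * Dz_qp G (point_mass n 1) m" for w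
    by (subst point_mass_scale, rule D_qp_scale)+
  note D_pq = Dx_pq_point_mass[OF pos, folded n] Dy_pq_point_mass[OF pos, folded n]
    Dz_pq_point_mass[OF pos, folded n]
  show ?thesis
    unfolding grad_pq_def grad_qp_def mult_point_mass D_pq
    \<comment> \<open>In full generality \<open>D_qp\<close> would loop on its own right-hand side,
      whose weight is 1.\<close>
    by (simp add: D_qp[of "_ * 1"] D_qp[of "b _ $ _"] algebra_simps)
qed

lemma grid_fun_unit_vec:
  assumes "c < n"
  shows "grid_fun n e (unit_vec n c) = point_mass (e c) 1"
proof
  fix m
  have "grid_fun n e (unit_vec n c) m
      = (\<Sum>d<n. if d = c then (if e c = m then 1 else 0) else 0)"
    unfolding grid_fun_def using assms by (intro sum.cong) (auto simp: unit_vec_def)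
  also have "\<dots> = point_mass (e c) 1 m"
    using assms by (auto simp: point_mass_def)
  finally show "grid_fun n e (unit_vec n c) m = point_mass (e c) 1 m" .
qed

lemma C_pq_carrier: "C_pq G e_p e_q b \<alpha> \<in> carrier_mat (dim_p G) (dim_q G)"
  by (simp add: C_pq_def matrix_of_def)

lemma C_qp_carrier: "C_qp G e_p e_q b \<beta> \<in> carrier_mat (dim_q G) (dim_p G)"
  by (simp add: C_qp_def matrix_of_def)

lemma C_pq_eq_uminus_transpose:
  assumes "enumerates e_p (interior_p_nodes G)"
  shows "C_pq G e_p e_q b \<alpha> = - transpose_mat (C_qp G e_p e_q b (1 - \<alpha>))"
proof (rule eq_matI)
  fix r c
  assume "r < dim_row (- transpose_mat (C_qp G e_p e_q b (1 - \<alpha>)))"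
    and "c < dim_col (- transpose_mat (C_qp G e_p e_q b (1 - \<alpha>)))"
  then have rc: "r < dim_p G" "c < dim_q G"
    using C_qp_carrier[of G e_p e_q b "1 - \<alpha>"] by auto
  have "e_p r \<in> interior_p_nodes G"
    using assms rc by (auto simp: enumerates_def dim_p_def dest: bij_betwE)
  from grad_pq_point_mass[OF this]
  show "C_pq G e_p e_q b \<alpha> $$ (r, c) = (- transpose_mat (C_qp G e_p e_q b (1 - \<alpha>))) $$ (r, c)"
    using rc by (simp add: C_pq_def C_qp_def matrix_of_def grid_fun_unit_vec)
qed (auto simp: C_pq_def C_qp_def matrix_of_def)

text \<open>The trapezoidal rule halves weights only at the indices 1 and \<open>N\<close>, while
  interior indices run from 2 to \<open>N - 1\<close>.\<close>

lemma X_p_eq_smult_one: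
  assumes "enumerates e_p (interior_p_nodes G)"
  shows "X_p G e_p = smult_mat (dx G * dy G * dz G) (1\<^sub>m (dim_p G))"
proof -
  have "p_weight G (e_p r) = dx G * dy G * dz G" if "r < dim_p G" for r
  proof -
    have "e_p r \<in> interior_p_nodes G"
      using assms that by (auto simp: enumerates_def dim_p_def dest: bij_betwE)
    then show ?thesis
      by (cases "e_p r") (auto simp: interior_p_nodes_def trapezoid_def)
  qed
  then show ?thesis
    by (intro eq_matI) (auto simp: X_p_def mat_diag_def)
qed

lemma smult_one_mult_mat:
  fixes A :: "'a::comm_ring_1 Matrix.mat"
  assumes "A \<in> carrier_mat n m"
  shows "smult_mat w (1\<^sub>m n) * A = smult_mat w A"
  using assms by (simp add: mult_smult_assoc_mat[of _ n n _ m])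

lemma scalar_prod_uminus_transpose:
  fixes A :: "real Matrix.mat"
  assumes "A \<in> carrier_mat m n" "p \<in> carrier_vec n" "q \<in> carrier_vec m"
  shows "scalar_prod p (smult_mat w (- transpose_mat A) *\<^sub>v q)
       + scalar_prod q (smult_mat w A *\<^sub>v p) = 0"
proof -
  have "scalar_prod p (transpose_mat A *\<^sub>v q) = scalar_prod q (A *\<^sub>v p)"
    using assms transpose_vec_mult_scalar[of A m n p q]
    by (metis comm_scalar_prod mult_mat_vec_carrier transpose_carrier_mat)
  \<comment> \<open>Moving sign and factor outside the product leaves two adjoint scalar products
    with opposite coefficients.\<close>
  moreover have "smult_mat w (- transpose_mat A) *\<^sub>v q
      = smult_vec (- w) (transpose_mat A *\<^sub>v q)"
    using assms by (intro eq_vecI) (auto simp: scalar_prod_def sum_distrib_left mult.assoc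
      simp flip: sum_negf)
  moreover have "smult_mat w A *\<^sub>v p = smult_vec w (A *\<^sub>v p)"
    using assms by (intro eq_vecI) (auto simp: scalar_prod_def sum_distrib_left mult.assoc)
  ultimately show ?thesis
    using assms by (simp add: scalar_prod_smult_right)
qed

theorem theorem1:
  fixes G :: staggered_grid
    and b :: "real^3 \<Rightarrow> real^3"
    and \<alpha> \<beta> :: real
    and e_p e_q :: "nat \<Rightarrow> node"
  assumes "valid_grid G"
    and "enumerates e_p (interior_p_nodes G)"
    and "enumerates e_q (q_nodes G)"
    and "divergence_free_on (Omega G) b"
    and "\<alpha> \<in> {0..1}" and "\<beta> \<in> {0..1}"
    and "\<alpha> + \<beta> = 1"
  shows "(\<forall>p \<in> carrier_vec (dim_p G). \<forall>q \<in> carrier_vec (dim_q G).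
            scalar_prod p ((X_p G e_p * C_pq G e_p e_q b \<alpha>) *\<^sub>v q)
          + scalar_prod q ((X_q G * C_qp G e_p e_q b \<beta>) *\<^sub>v p) = 0)
       \<and> C_pq G e_p e_q b \<alpha> = - transpose_mat (C_qp G e_p e_q b \<beta>)"
proof -
  have "\<beta> = 1 - \<alpha>"
    using assms(7) by simp
  then have C: "C_pq G e_p e_q b \<alpha> = - transpose_mat (C_qp G e_p e_q b \<beta>)"
    using C_pq_eq_uminus_transpose[OF assms(2)] by simp
  have "X_p G e_p * C_pq G e_p e_q b \<alpha>
      = smult_mat (dx G * dy G * dz G) (- transpose_mat (C_qp G e_p e_q b \<beta>))"
    using smult_one_mult_mat[OF C_pq_carrier] X_p_eq_smult_one[OF assms(2)] C by metis
  moreover have "X_q G * C_qp G e_p e_q b \<beta>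
      = smult_mat (dx G * dy G * dz G) (C_qp G e_p e_q b \<beta>)"
    unfolding X_q_def by (rule smult_one_mult_mat[OF C_qp_carrier])
  ultimately show ?thesis
    using C scalar_prod_uminus_transpose[OF C_qp_carrier] by simp
qed

end
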